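(* Let $(\Omega,\mathcal A,P)$ be a probability space, let $\{A_n, n\ge 1\}$ be a sequence of events in $\mathcal A$, and let $\mathcal F\subseteq\mathcal A$ be a sub-$\sigma$-algebra such that $P(A_n\mid\mathcal F)\to 0$ almost surely as $n\to\infty$. Suppose further that $$\sum_{n=1}^\infty P(A_n^c A_{n+1}\mid\mathcal F)<\infty\quad\text{almost surely.}$$ Then $P(\limsup A_n\mid\mathcal F)=0$ almost surely, and hence $P(\limsup A_n)=0$.
   Context: $\limsup A_n=\bigcap_{n=1}^\infty\bigcup_{i=n}^\infty A_i$ is the event that $A_n$ occurs infinitely often. $A^c$ is the complement of $A$, and juxtaposition of events denotes intersection, so $A_n^cA_{n+1}=A_n^c\cap A_{n+1}$. $P(A\mid\mathcal F)=E[\mathbf 1_A\mid\mathcal F]$. *)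

theory Defs
  imports "HOL-Probability.Probability"
begin

definition event_cond_exp :: "'a measure \<Rightarrow> 'a measure \<Rightarrow> 'a set \<Rightarrow> 'a \<Rightarrow> real" where
  "event_cond_exp M F A = real_cond_exp M F (indicator A)"

text \<open>The library's \<open>limsup\<close> on sets is the event that \<open>A n\<close> occurs infinitely often; it does
  not depend on the value \<open>A 0\<close>, so it is the limsup of the sequence indexed by \<open>n \<ge> 1\<close>.\<close>

lemma limsup_events_eq:
  fixes A :: "nat \<Rightarrow> 'a set"
  shows "limsup A = (\<Inter>n\<in>{1..}. \<Union>i\<in>{n..}. A i)"
proof -
  have "limsup A = (\<Inter>n. \<Union>i\<in>{n..}. A i)"
    by (simp add: limsup_INF_SUP)
  also have "\<dots> = (\<Inter>n\<in>{1..}. \<Union>i\<in>{n..}. A i)"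
  proof (intro equalityI subsetI INT_I)
    fix x n assume x: "x \<in> (\<Inter>n\<in>{1..}. \<Union>i\<in>{n..}. A i)"
    have "x \<in> (\<Union>i\<in>{Suc n..}. A i)"
      using x by (rule INT_D) simp
    then show "x \<in> (\<Union>i\<in>{n..}. A i)"
      by (auto dest: Suc_leD)
  qed auto
  finally show ?thesis .
qed

end

(* A conditional first Borel-Cantelli lemma holds: on the event that all partial sums of
   P(D_n | F) stay below K, which lies in F, the ordinary Borel-Cantelli lemma applies to the D_n,
   and by summability these events exhaust the space. With D_n = A_n^c A_(n+1), almost surely the
   indicator of A_n jumps upwards only finitely often, so a point of limsup A_n is eventually in
   every A_n. But P(liminf A_n) <= liminf P(A_n) = 0 by dominated convergence. *)
theory Submission
  imports Defs
begin

context finite_measure_subalgebra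
begin

lemma integrable_event_cond_exp [simp]:
  assumes "A \<in> sets M"
  shows "integrable M (event_cond_exp M F A)"
  unfolding event_cond_exp_def using assms
  by (intro real_cond_exp_int) (simp add: emeasure_finite less_top[symmetric])

text \<open>This is the defining property of conditional expectation: the test function
  \<open>indicator G\<close> is \<open>F\<close>-measurable. It converts integrals of conditional
  probabilities over \<open>G\<close> into ordinary probabilities.\<close>

lemma integral_indicator_event_cond_exp:
  assumes "A \<in> sets M" and "G \<in> sets F"
  shows "(\<integral>x. indicator G x * event_cond_exp M F A x \<partial>M) = measure M (G \<inter> A)"
proof -
  have G: "G \<in> sets M"
    using assms(2) subalg by (auto simp: subalgebra_def)
  have "(\<integral>x. indicator G x * event_cond_exp M F A x \<partial>M)
      = (\<integral>x. indicator G x * indicator A x \<partial>M)"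
    unfolding event_cond_exp_def using assms G
    by (intro real_cond_exp_intg)
      (auto simp: indicator_inter_arith[symmetric] emeasure_finite less_top[symmetric])
  also have "\<dots> = measure M (G \<inter> A)"
    using assms G by (simp add: indicator_inter_arith[symmetric])
  finally show ?thesis .
qed

lemma integral_event_cond_exp:
  assumes "A \<in> sets M"
  shows "(\<integral>x. event_cond_exp M F A x \<partial>M) = measure M A"
proof -
  have "(\<integral>x. event_cond_exp M F A x \<partial>M) = (\<integral>x. indicator A x \<partial>M)"
    unfolding event_cond_exp_def using assms
    by (intro real_cond_exp_int) (simp add: emeasure_finite less_top[symmetric])
  then show ?thesis
    using assms by simp
qed

lemma AE_event_cond_exp_bounds:
  assumes "A \<in> sets M"
  shows "AE x in M. 0 \<le> event_cond_exp M F A x \<and> event_cond_exp M F A x \<le> 1"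
proof -
  have "integrable M (indicator A :: 'a \<Rightarrow> real)"
    using assms by (simp add: emeasure_finite less_top[symmetric])
  then show ?thesis
    unfolding event_cond_exp_def
    by (intro AE_conjI real_cond_exp_ge_c real_cond_exp_le_c) (auto simp: indicator_def)
qed

lemma conditional_borel_cantelli:
  assumes D [measurable]: "\<And>n. D n \<in> sets M"
    and summable: "AE x in M. summable (\<lambda>n. event_cond_exp M F (D n) x)"
  shows "AE x in M. eventually (\<lambda>n. x \<notin> D n) sequentially"
proof -
  define d where "d n = event_cond_exp M F (D n)" for n :: nat
  have [measurable]: "d n \<in> borel_measurable F" for n
    unfolding d_def event_cond_exp_def by simp
  \<comment> \<open>Localisation: \<open>G K\<close> is cut out by \<open>F\<close>-measurable
    functions, so it lies in \<open>F\<close> and may serve as a test set.\<close>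
  define G where "G K = {x \<in> space F. \<forall>n. (\<Sum>i<n. d i x) \<le> real K}" for K :: nat
  have GF [measurable]: "G K \<in> sets F" for K
    unfolding G_def by measurable
  have GM [measurable]: "G K \<in> sets M" for K
    using GF subalg by (auto simp: subalgebra_def)
  have int: "integrable M (\<lambda>x. indicator (G K) x * d i x)" for K i
    using integrable_mult_indicator[OF GM integrable_event_cond_exp[OF D]]
    by (simp add: d_def)
  have "AE x in M. eventually (\<lambda>n. x \<in> space M - G K \<inter> D n) sequentially" for K
  proof (rule borel_cantelli_AE1)
    show "summable (\<lambda>n. measure M (G K \<inter> D n))"
    proof (rule summableI_nonneg_bounded)
      fix n
      have "(\<Sum>i<n. measure M (G K \<inter> D i)) = (\<Sum>i<n. \<integral>x. indicator (G K) x * d i x \<partial>M)"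
        by (simp add: integral_indicator_event_cond_exp d_def)
      also have "\<dots> = (\<integral>x. (\<Sum>i<n. indicator (G K) x * d i x) \<partial>M)"
        using int by (intro Bochner_Integration.integral_sum[symmetric])
      \<comment> \<open>On \<open>G K\<close> the partial sum is at most \<open>K\<close>; off
        \<open>G K\<close> the integrand vanishes. The resulting bound is the same for all
        \<open>n\<close>.\<close>
      also have "\<dots> \<le> (\<integral>x. real K \<partial>M)"
      proof (rule integral_mono)
        show "integrable M (\<lambda>x. \<Sum>i<n. indicator (G K) x * d i x)"
          using int by (intro Bochner_Integration.integrable_sum)
      qed (auto simp: sum_distrib_left[symmetric] G_def indicator_def)
      finally show "(\<Sum>i<n. measure M (G K \<inter> D i)) \<le> (\<integral>x. real K \<partial>M)" .
    qed simp
  qed (auto simp: emeasure_finite less_top[symmetric])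
  \<comment> \<open>There are countably many levels \<open>K\<close>, so one null set serves them
    all and the level may afterwards depend on \<open>x\<close>.\<close>
  then have "AE x in M. \<forall>K. eventually (\<lambda>n. x \<in> space M - G K \<inter> D n) sequentially"
    unfolding AE_all_countable by blast
  with summable AE_space show ?thesis
  proof eventually_elim
    case (elim x)
    \<comment> \<open>Partial sums of a convergent series are bounded, which places \<open>x\<close>
      in some \<open>G K\<close>.\<close>
    from elim(1) have "Bseq (\<lambda>n. \<Sum>i<n. d i x)"
      unfolding d_def by (intro convergent_imp_Bseq) (simp add: summable_iff_convergent)
    then obtain B where B: "\<forall>n. norm (\<Sum>i<n. d i x) \<le> B"
      by (auto simp: Bseq_def)
    obtain K :: nat where "B \<le> real K"
      using real_arch_simple by blast
    with B have "(\<Sum>i<n. d i x) \<le> real K" for n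
      by (smt (verit) real_norm_def)
    moreover have "x \<in> space F"
      using elim(2) subalg by (simp add: subalgebra_def)
    ultimately have "x \<in> G K"
      by (simp add: G_def)
    with elim(3) show ?case
      by (auto elim: eventually_mono)
  qed
qed

text \<open>The mean of a conditional probability is the probability itself, and its values lie
  between 0 and 1 almost surely, so dominated convergence applies with the constant 1.\<close>

lemma measure_tendsto_0_if_event_cond_exp_tendsto_0:
  assumes B: "\<And>n. B n \<in> sets M"
    and lim: "AE x in M. (\<lambda>n. event_cond_exp M F (B n) x) \<longlonglongrightarrow> 0"
  shows "(\<lambda>n. measure M (B n)) \<longlonglongrightarrow> 0"
proof -
  have "(\<lambda>n. \<integral>x. event_cond_exp M F (B n) x \<partial>M) \<longlonglongrightarrow> (\<integral>x. 0 \<partial>M)"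
  proof (rule integral_dominated_convergence[where w = "\<lambda>_. 1"])
    fix n
    show "AE x in M. norm (event_cond_exp M F (B n) x) \<le> 1"
      using AE_event_cond_exp_bounds[OF B[of n]] by eventually_elim simp
  qed (use lim B in \<open>auto intro: borel_measurable_integrable\<close>)
  then show ?thesis
    by (simp add: integral_event_cond_exp B)
qed

text \<open>The indicator agrees almost everywhere with the zero function, which is
  \<open>F\<close>-measurable and hence its own conditional expectation.\<close>

lemma AE_event_cond_exp_null:
  assumes "A \<in> null_sets M"
  shows "AE x in M. event_cond_exp M F A x = 0"
proof -
  have "AE x in M. (indicator A x :: real) = 0"
    using AE_not_in[OF assms] by eventually_elim simp
  then have "AE x in M. event_cond_exp M F A x = real_cond_exp M F (\<lambda>_. 0) x"
    unfolding event_cond_exp_def using assms by (intro real_cond_exp_cong) auto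
  moreover have "AE x in M. real_cond_exp M F (\<lambda>_. 0) x = 0"
    by (rule real_cond_exp_F_meas) auto
  ultimately show ?thesis
    by eventually_elim simp
qed

end

text \<open>The points lying in all \<open>B i\<close> with \<open>i \<ge> n\<close> form a subset
  of each such \<open>B i\<close>, so their measure is at most the limit 0; there are only countably
  many \<open>n\<close>.\<close>

lemma (in finite_measure) AE_not_eventually_in:
  assumes B [measurable]: "\<And>n. B n \<in> sets M"
    and lim: "(\<lambda>n. measure M (B n)) \<longlonglongrightarrow> 0"
  shows "AE x in M. \<not> eventually (\<lambda>n. x \<in> B n) sequentially"
proof -
  have "AE x in M. \<not> (\<forall>i\<ge>n. x \<in> B i)" for n
  proof -
    define C where "C = {x \<in> space M. \<forall>i\<ge>n. x \<in> B i}"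
    have C [measurable]: "C \<in> sets M"
      unfolding C_def by measurable
    have "measure M C \<le> measure M (B i)" if "i \<ge> n" for i
      using that by (intro finite_measure_mono) (auto simp: C_def)
    then have "measure M C \<le> 0"
      by (intro LIMSEQ_le_const[OF lim]) auto
    then have "C \<in> null_sets M"
      using C by (auto simp: emeasure_eq_measure measure_le_0_iff)
    from AE_not_in[OF this] AE_space show ?thesis
      by eventually_elim (auto simp: C_def)
  qed
  then show ?thesis
    by (simp add: eventually_sequentially AE_all_countable)
qed

text \<open>Past some \<open>N\<close> no entry occurs, so a point found outside at some
  \<open>m \<ge> N\<close> stays outside by induction.\<close>

lemma eventually_notin_if_finitely_many_entries:
  assumes "eventually (\<lambda>n. \<not> (x \<notin> B n \<and> x \<in> B (Suc n))) sequentially"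
    and "\<not> eventually (\<lambda>n. x \<in> B n) sequentially"
  shows "eventually (\<lambda>n. x \<notin> B n) sequentially"
proof -
  obtain N where N: "\<And>n. n \<ge> N \<Longrightarrow> x \<notin> B n \<Longrightarrow> x \<notin> B (Suc n)"
    using assms(1) by (auto simp: eventually_sequentially)
  obtain m where m: "m \<ge> N" "x \<notin> B m"
    using assms(2) by (auto simp: eventually_sequentially)
  have "x \<notin> B n" if "n \<ge> m" for n
    using that by (induction rule: dec_induct) (use m N in auto)
  then show ?thesis
    by (auto simp: eventually_sequentially)
qed

theorem theorem1p6:
  fixes M F :: "'a measure" and A :: "nat \<Rightarrow> 'a set"
  assumes "prob_space M"
    and "subalgebra M F"
    and "\<And>n. n \<ge> 1 \<Longrightarrow> A n \<in> sets M"
    and "AE x in M. (\<lambda>n. event_cond_exp M F (A n) x) \<longlonglongrightarrow> 0"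
    and "AE x in M. summable (\<lambda>n. event_cond_exp M F
            ((space M - A (Suc n)) \<inter> A (Suc (Suc n))) x)"
  shows "(AE x in M. event_cond_exp M F (limsup A) x = 0) \<and> measure M (limsup A) = 0"
proof -
  interpret prob_space M by fact
  interpret finite_measure_subalgebra M F
    by unfold_locales fact
  \<comment> \<open>The hypotheses start at index 1, so \<open>A 0\<close> may be non-measurable;
    the shifted sequence is measurable throughout and has the same limsup.\<close>
  define B where "B n = A (Suc n)" for n
  have B [measurable]: "B n \<in> sets M" for n
    using assms(3) by (simp add: B_def)
  have limsup_eq: "limsup A = {x. \<not> eventually (\<lambda>n. x \<notin> B n) sequentially}"
    unfolding B_def eventually_sequentially_Suc[of "\<lambda>n. x \<notin> A n" for x]
    by (auto simp: limsup_INF_SUP eventually_sequentially)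
  have "limsup A = limsup B"
    unfolding limsup_eq by (auto simp: limsup_INF_SUP eventually_sequentially)
  then have meas: "limsup A \<in> sets M"
    by simp
  have "AE x in M. (\<lambda>n. event_cond_exp M F (B n) x) \<longlonglongrightarrow> 0"
    using assms(4) unfolding B_def by eventually_elim (rule LIMSEQ_Suc)
  then have "AE x in M. \<not> eventually (\<lambda>n. x \<in> B n) sequentially"
    by (intro AE_not_eventually_in measure_tendsto_0_if_event_cond_exp_tendsto_0 B)
  moreover have "AE x in M. eventually (\<lambda>n. x \<notin> (space M - B n) \<inter> B (Suc n)) sequentially"
    using assms(5) by (intro conditional_borel_cantelli) (auto simp: B_def[symmetric])
  \<comment> \<open>For \<open>x\<close> in \<open>space M\<close>, avoiding
    \<open>(space M - B n) \<inter> B (Suc n)\<close> means exactly that no entry occurs at step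
    \<open>n\<close>.\<close>
  ultimately have "AE x in M. x \<notin> limsup A"
    using AE_space
  proof eventually_elim
    case (elim x)
    then show ?case
      unfolding limsup_eq by (auto intro: eventually_notin_if_finitely_many_entries)
  qed
  then have null: "limsup A \<in> null_sets M"
    using meas by (simp add: AE_iff_null_sets)
  then show ?thesis
    using AE_event_cond_exp_null[OF null] by (simp add: measure_eq_0_null_sets)
qed

end
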